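(* Let $(P,\leq)$ be a poset and let $\mathcal{U}$ be the set of artinian and narrow subsets of $P$. Then $(P,\mathcal{U})$ is a finiteness space.
   Context: For a set $X$ and a collection $\mathcal{U}\subseteq\mathcal{P}(X)$ of subsets, put $\mathcal{U}^\perp=\{u'\subseteq X \mid u'\cap u \text{ is finite for all } u\in\mathcal{U}\}$. A finiteness space is a pair $(X,\mathcal{U})$ with $X$ a set and $\mathcal{U}\subseteq\mathcal{P}(X)$ such that $\mathcal{U}^{\perp\perp}=\mathcal{U}$. A poset is artinian if every strictly descending chain $m_1>m_2>\cdots$ in it is finite, and narrow if every subset of pairwise incomparable elements (discrete subset) is finite. A subset of a poset is called artinian (resp. narrow) if it is so for the induced order. *)

theory Defs
  imports Main
begin

definition perp :: "'a set \<Rightarrow> 'a set set \<Rightarrow> 'a set set" where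
  "perp X \<U> = {u'. u' \<subseteq> X \<and> (\<forall>u\<in>\<U>. finite (u' \<inter> u))}"

definition finiteness_space :: "'a set \<Rightarrow> 'a set set \<Rightarrow> bool" where
  "finiteness_space X \<U> \<longleftrightarrow> \<U> \<subseteq> Pow X \<and> perp X (perp X \<U>) = \<U>"

(* A poset is a carrier P together with its non-strict order r, partial_order_on P r,
   where (x, y) \<in> r means x \<le> y. *)

definition artinian :: "'a set \<Rightarrow> 'a rel \<Rightarrow> bool" where
  "artinian P r \<longleftrightarrow>
     \<not> (\<exists>m :: nat \<Rightarrow> 'a. (\<forall>i. m i \<in> P) \<and> (\<forall>i. (m (Suc i), m i) \<in> r \<and> m (Suc i) \<noteq> m i))"

definition narrow :: "'a set \<Rightarrow> 'a rel \<Rightarrow> bool" where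
  "narrow P r \<longleftrightarrow>
     (\<forall>D. D \<subseteq> P \<and> (\<forall>x\<in>D. \<forall>y\<in>D. x \<noteq> y \<longrightarrow> (x, y) \<notin> r \<and> (y, x) \<notin> r) \<longrightarrow> finite D)"

(* Restr r A is the order induced by r on A. *)

definition artinian_subset :: "'a rel \<Rightarrow> 'a set \<Rightarrow> bool" where
  "artinian_subset r A \<longleftrightarrow> artinian A (Restr r A)"

definition narrow_subset :: "'a rel \<Rightarrow> 'a set \<Rightarrow> bool" where
  "narrow_subset r A \<longleftrightarrow> narrow A (Restr r A)"

end

theory Submission
  imports Defs "HOL-Library.Infinite_Set"
begin

text \<open>An infinite strictly descending chain, or an infinite antichain, meets every artinian and
narrow subset in a finite set, hence lies in \<open>\<U>\<^sup>\<bottom>\<close>; so no member of \<open>\<U>\<^sup>\<bottom>\<^sup>\<bottom>\<close> can contain one.\<close>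

lemma subset_perp_perp:
  assumes "\<U> \<subseteq> Pow X"
  shows "\<U> \<subseteq> perp X (perp X \<U>)"
  using assms by (auto simp: perp_def Int_commute)

text \<open>Since \<open>D \<subseteq> A \<subseteq> X\<close>, the last assumption puts
  \<open>D\<close> in \<open>perp X \<U>\<close>. So \<open>A\<close> meets \<open>D\<close> in a
  finite set, and that intersection is \<open>D\<close> itself.\<close>

lemma perp_perp_subset_finite:
  assumes "A \<in> perp X (perp X \<U>)" and "D \<subseteq> A" and "\<And>u. u \<in> \<U> \<Longrightarrow> finite (D \<inter> u)"
  shows "finite D"
proof -
  have "D \<in> perp X \<U>"
    using assms by (auto simp: perp_def)
  then have "finite (A \<inter> D)"
    using assms(1) by (auto simp: perp_def)
  then show ?thesis
    using assms(2) by (simp add: Int_absorb1)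
qed

lemma descending_chain_less:
  assumes "trans r" "antisym r"
    and "\<And>i. (m (Suc i), m i) \<in> r \<and> m (Suc i) \<noteq> m i"
    and "i < j"
  shows "(m j, m i) \<in> r \<and> m j \<noteq> m i"
  using \<open>i < j\<close>
proof (induction rule: less_Suc_induct)
  case (1 i)
  then show ?case using assms(3) by blast
next
  case (2 i j k)
  \<comment> \<open>If \<open>m k = m i\<close>, then \<open>m i\<close> and \<open>m j\<close> lie
    below each other, so antisymmetry would force \<open>m j = m i\<close>.\<close>
  then show ?case
    using transD[OF assms(1), of "m k" "m j" "m i"] antisymD[OF assms(2), of "m j" "m i"] by metis
qed

text \<open>Otherwise infinitely many indices land in \<open>u\<close>. Enumerated increasingly,
  they give an infinite strictly descending subchain inside \<open>u\<close>.\<close>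

lemma descending_chain_finite_inter:
  assumes "trans r" "antisym r"
    and m: "\<And>i. (m (Suc i), m i) \<in> r \<and> m (Suc i) \<noteq> m i"
    and u: "artinian_subset r u"
  shows "finite (range m \<inter> u)"
proof (rule ccontr)
  assume "infinite (range m \<inter> u)"
  moreover have "range m \<inter> u = m ` {i. m i \<in> u}"
    by auto
  ultimately have "infinite {i. m i \<in> u}"
    by auto
  then obtain f :: "nat \<Rightarrow> nat" where "strict_mono f" and f: "\<And>n. m (f n) \<in> u"
    using infinite_enumerate by blast
  \<comment> \<open>\<open>f n\<close> and \<open>f (Suc n)\<close> need not be consecutive, so the
    descent between arbitrary indices is used.\<close>
  then have "(m (f (Suc n)), m (f n)) \<in> r \<and> m (f (Suc n)) \<noteq> m (f n)" for n
    by (intro descending_chain_less[of r m, OF assms(1,2) m]) (simp add: strict_mono_Suc_iff)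
  then show False
    using u f unfolding artinian_subset_def artinian_def
    by (auto dest: spec[of _ "\<lambda>n. m (f n)"])
qed

text \<open>Subsets of antichains are antichains, and this one lies inside \<open>u\<close>.\<close>

lemma antichain_finite_inter:
  assumes "\<And>x y. x \<in> D \<Longrightarrow> y \<in> D \<Longrightarrow> x \<noteq> y \<Longrightarrow> (x, y) \<notin> r"
    and "narrow_subset r u"
  shows "finite (D \<inter> u)"
  using assms(2) unfolding narrow_subset_def narrow_def
  by (rule allE[of _ "D \<inter> u"]) (use assms(1) in auto)

theorem theorem3:
  fixes P :: "'a set" and r :: "'a rel"
  assumes "partial_order_on P r"
  shows "finiteness_space P {A. A \<subseteq> P \<and> artinian_subset r A \<and> narrow_subset r A}"
proof -
  let ?U = "{A. A \<subseteq> P \<and> artinian_subset r A \<and> narrow_subset r A}"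
  have r: "trans r" "antisym r"
    using assms by (auto simp: partial_order_on_def preorder_on_def)
  \<comment> \<open>Only this inclusion depends on the order; the converse holds for any family of
    subsets of \<open>P\<close>.\<close>
  have "A \<in> ?U" if A: "A \<in> perp P (perp P ?U)" for A
  proof -
    have "artinian_subset r A"
    proof (rule ccontr)
      assume "\<not> artinian_subset r A"
      then obtain m :: "nat \<Rightarrow> 'a" where mA: "range m \<subseteq> A"
        and m: "\<And>i. (m (Suc i), m i) \<in> r \<and> m (Suc i) \<noteq> m i"
        unfolding artinian_subset_def artinian_def by blast
      have "finite (range m)"
        by (rule perp_perp_subset_finite[OF A mA]) (use descending_chain_finite_inter[of r m, OF r m] in blast)
      \<comment> \<open>Strict descent between any two indices rules out repetitions, so the range
        of \<open>m\<close> is infinite.\<close>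
      moreover have "inj m"
        by (rule linorder_injI) (metis descending_chain_less[of r m, OF r m])
      ultimately show False
        using finite_imageD by blast
    qed
    moreover have "narrow_subset r A"
      unfolding narrow_subset_def narrow_def
    proof (intro allI impI, elim conjE)
      fix D
      assume DA: "D \<subseteq> A"
        and "\<forall>x\<in>D. \<forall>y\<in>D. x \<noteq> y \<longrightarrow> (x, y) \<notin> Restr r A \<and> (y, x) \<notin> Restr r A"
      \<comment> \<open>As \<open>D \<subseteq> A\<close>, incomparability for
        \<open>Restr r A\<close> and for \<open>r\<close> agree on \<open>D\<close>.\<close>
      then have "\<And>x y. x \<in> D \<Longrightarrow> y \<in> D \<Longrightarrow> x \<noteq> y \<Longrightarrow> (x, y) \<notin> r"
        by blast
      then show "finite D"
        by (intro perp_perp_subset_finite[OF A DA] antichain_finite_inter[of D r]) auto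
    qed
    ultimately show ?thesis
      using A by (simp add: perp_def)
  qed
  moreover have "?U \<subseteq> Pow P"
    by auto
  ultimately show ?thesis
    unfolding finiteness_space_def using subset_perp_perp[of ?U P] by blast
qed

end
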